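(* Let $(Y,\mathbf{X})$ be a $(d+1)$-dimensional random vector such that the distribution function $F_Y$ of $Y$ is continuous. Then $\phi_{(Y,\mathbf{X})}(t)=2t-t^2$ for all $t\in[0,1]$ if and only if $Y$ and $\mathbf{X}$ are independent.
   Context: $Y$ is real-valued and $\mathbf{X}$ takes values in $\mathbb{R}^d$, $d\ge 1$. $Y'$ is a random variable (on a possibly extended probability space) such that, conditionally on $\mathbf{X}$, $Y$ and $Y'$ are independent and identically distributed, i.e. $\mathbb{P}(Y\in A, Y'\in B\mid \mathbf{X})=\mathbb{P}(Y\in A\mid\mathbf{X})\,\mathbb{P}(Y\in B\mid\mathbf{X})$ almost surely for all Borel sets $A,B\subseteq\mathbb{R}$. For $t\in[0,1]$, $$\phi_{(Y,\mathbf{X})}(t):=\mathbb{P}\bigl(|F_Y(Y)-F_Y(Y')|\le t\bigr).$$ *)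

theory Defs
  imports "HOL-Probability.Probability"
begin

text \<open>The library's \<open>indep_var\<close> requires both random variables to have the same value type.
  This is independence of the generated \<sigma>-algebras, for values in possibly different types.\<close>

definition indep_random_vars ::
  "'a measure \<Rightarrow> ('a \<Rightarrow> 'b::topological_space) \<Rightarrow> ('a \<Rightarrow> 'c::topological_space) \<Rightarrow> bool" where
  "indep_random_vars M U V \<longleftrightarrow>
     prob_space.indep_set M (sets (vimage_algebra (space M) U borel))
                            (sets (vimage_algebra (space M) V borel))"

definition cond_prob_given ::
  "'a measure \<Rightarrow> ('a \<Rightarrow> 'b::topological_space) \<Rightarrow> 'a set \<Rightarrow> 'a \<Rightarrow> real" where
  "cond_prob_given M X E =
     real_cond_exp M (vimage_algebra (space M) X borel) (indicator E)"

text \<open>The right-hand side uses \<open>Y\<close> in both factors: taking \<open>A = UNIV\<close> shows that \<open>Y'\<close> has the same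
  conditional law given \<open>X\<close> as \<open>Y\<close>.\<close>

definition cond_iid_copy ::
  "'a measure \<Rightarrow> ('a \<Rightarrow> 'b::topological_space) \<Rightarrow> ('a \<Rightarrow> real) \<Rightarrow> ('a \<Rightarrow> real) \<Rightarrow> bool" where
  "cond_iid_copy M X Y Y' \<longleftrightarrow>
     Y' \<in> borel_measurable M \<and>
     (\<forall>A\<in>sets borel. \<forall>B\<in>sets borel. AE \<omega> in M.
        cond_prob_given M X {\<omega>' \<in> space M. Y \<omega>' \<in> A \<and> Y' \<omega>' \<in> B} \<omega> =
        cond_prob_given M X {\<omega>' \<in> space M. Y \<omega>' \<in> A} \<omega> *
        cond_prob_given M X {\<omega>' \<in> space M. Y \<omega>' \<in> B} \<omega>)"

text \<open>\<open>N\<close> extends \<open>M\<close> along \<open>\<pi>\<close>; a random variable \<open>Z\<close> on \<open>M\<close> is read on \<open>N\<close> as \<open>Z \<circ> \<pi>\<close>.\<close>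

definition prob_space_extension :: "'a measure \<Rightarrow> 'b measure \<Rightarrow> ('b \<Rightarrow> 'a) \<Rightarrow> bool" where
  "prob_space_extension M N \<pi> \<longleftrightarrow>
     prob_space N \<and> \<pi> \<in> measurable N M \<and> distr N M \<pi> = M"

definition distribution_function :: "'a measure \<Rightarrow> ('a \<Rightarrow> real) \<Rightarrow> real \<Rightarrow> real" where
  "distribution_function M Y = cdf (distr M borel Y)"

text \<open>The dependence on \<open>X\<close> is only through the copy \<open>Y'\<close>, a conditionally i.i.d. copy of \<open>Y\<close>
  given \<open>X\<close>.\<close>

definition phi :: "'a measure \<Rightarrow> ('a \<Rightarrow> real) \<Rightarrow> ('a \<Rightarrow> real) \<Rightarrow> real \<Rightarrow> real" where
  "phi M Y Y' t =
     measure M {\<omega> \<in> space M.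
       \<bar>distribution_function M Y (Y \<omega>) - distribution_function M Y (Y' \<omega>)\<bar> \<le> t}"

end

theory Submission
  imports Defs
begin

text \<open>
  Write \<open>D\<close> for the law of \<open>Y\<close>, \<open>F\<close> for its distribution function and
  \<open>p\<^sub>y = P(Y \<le> y | X)\<close>. The copy \<open>Y'\<close> has law \<open>D\<close> as well, and conditional independence gives
  \<open>G y := P(Y \<le> y, Y' \<le> y) = E p\<^sub>y\<^sup>2\<close>. Since \<open>E p\<^sub>y = F y\<close>, the difference
  \<open>G y - (F y)\<^sup>2\<close> is the variance of \<open>p\<^sub>y\<close>: it is nonnegative, and it vanishes exactly when
  \<open>p\<^sub>y\<close> is almost surely constant, that is, when the event \<open>Y \<le> y\<close> is independent of \<open>X\<close>.
  So \<open>Y\<close> and \<open>X\<close> are independent if and only if \<open>G = F\<^sup>2\<close> everywhere.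

  If \<open>Y\<close> and \<open>X\<close> are independent, then all conditional probabilities \<open>P(Y \<in> A | X)\<close> are constant
  and \<open>(Y, Y')\<close> has law \<open>D \<otimes> D\<close>. By the probability integral transform \<open>F(Y)\<close> and \<open>F(Y')\<close> are
  then independent and uniform on \<open>[0,1]\<close>, and \<open>2t - t\<^sup>2\<close> is the area of the strip
  \<open>\<bar>u - v\<bar> \<le> t\<close> in the unit square (\<open>pair_prob_cdf_diff_le\<close>).

  For the converse only the mean of the gap \<open>\<bar>F(Y) - F(Y')\<bar>\<close> matters. The gap is the
  \<open>D\<close>-measure of the set of those \<open>y\<close> that separate \<open>Y\<close> from \<open>Y'\<close>, so Fubini's theorem gives the mean
  \<open>2 \<integral> (F - G) dD\<close> (\<open>expectation_cdf_diff\<close>). If the gap has the same law as under \<open>D \<otimes> D\<close>, where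
  \<open>G\<close> is replaced by \<open>F\<^sup>2\<close>, then comparing the two means yields \<open>\<integral> (G - F\<^sup>2) dD = 0\<close>. The integrand is
  nonnegative, hence zero \<open>D\<close>-almost everywhere, and it varies no faster than \<open>F\<close>, hence it is zero
  everywhere (\<open>joint_cdf_eq_square\<close>).
\<close>

section \<open>Independence of random variables with different value types\<close>

lemma indep_random_vars_iff:
  fixes U :: "'a \<Rightarrow> 'b::topological_space" and V :: "'a \<Rightarrow> 'c::topological_space"
  assumes "prob_space M" and U: "U \<in> borel_measurable M" and V: "V \<in> borel_measurable M"
  shows "indep_random_vars M U V \<longleftrightarrow>
    (\<forall>A\<in>sets borel. \<forall>B\<in>sets borel.
      measure M ((U -` A \<inter> space M) \<inter> (V -` B \<inter> space M)) =
      measure M (U -` A \<inter> space M) * measure M (V -` B \<inter> space M))"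
proof -
  interpret prob_space M by fact
  have sets: "sets (vimage_algebra (space M) U borel) = {U -` A \<inter> space M | A. A \<in> sets borel}"
    "sets (vimage_algebra (space M) V borel) = {V -` A \<inter> space M | A. A \<in> sets borel}"
    by (auto simp: sets_vimage_algebra2)
  have "sets (vimage_algebra (space M) U borel) \<subseteq> events"
    "sets (vimage_algebra (space M) V borel) \<subseteq> events"
    using measurable_sets[OF U] measurable_sets[OF V] unfolding sets by blast+
  then have "indep_random_vars M U V \<longleftrightarrow>
      (\<forall>a\<in>sets (vimage_algebra (space M) U borel). \<forall>b\<in>sets (vimage_algebra (space M) V borel).
        prob (a \<inter> b) = prob a * prob b)"
    unfolding indep_random_vars_def indep_sets2_eq by simp
  then show ?thesis
    unfolding sets Setcompr_eq_image ball_simps by simp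
qed

text \<open>The half-lines form an intersection-stable generator of the Borel sets.\<close>

lemma indep_random_vars_realI:
  fixes U :: "'a \<Rightarrow> real" and V :: "'a \<Rightarrow> 'c::topological_space"
  assumes "prob_space M" and U: "U \<in> borel_measurable M" and V: "V \<in> borel_measurable M"
    and half_lines: "\<And>y B. B \<in> sets borel \<Longrightarrow>
      measure M ((U -` {..y} \<inter> space M) \<inter> (V -` B \<inter> space M)) =
      measure M (U -` {..y} \<inter> space M) * measure M (V -` B \<inter> space M)"
  shows "indep_random_vars M U V"
proof -
  interpret prob_space M by fact
  let ?G = "{U -` {..y} \<inter> space M | y. True}"
  have U_sets: "sets (vimage_algebra (space M) U borel) = sigma_sets (space M) ?G"
  proof -
    have "vimage_algebra (space M) U (sigma UNIV (range atMost)) =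
        sigma (space M) {U -` A \<inter> space M | A. A \<in> range atMost}"
      by (rule vimage_algebra_sigma) auto
    also have "{U -` A \<inter> space M | A. A \<in> range atMost} = ?G"
      by auto
    finally show ?thesis
      unfolding borel_eq_atMost by (simp only:) (rule sets_measure_of, auto)
  qed
  have V_sets: "sets (vimage_algebra (space M) V borel) = {V -` B \<inter> space M | B. B \<in> sets borel}"
    by (auto simp: sets_vimage_algebra2)
  have "indep_set ?G (sets (vimage_algebra (space M) V borel))"
    unfolding indep_sets2_eq V_sets
    using measurable_sets[OF U] measurable_sets[OF V] half_lines by auto
  moreover have "Int_stable ?G"
  proof (rule Int_stableI, clarify)
    fix y z
    have "(U -` {..y} \<inter> space M) \<inter> (U -` {..z} \<inter> space M) = U -` {..min y z} \<inter> space M"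
      by auto
    then show "\<exists>x. (U -` {..y} \<inter> space M) \<inter> (U -` {..z} \<inter> space M) = U -` {..x} \<inter> space M \<and> True"
      by blast
  qed
  moreover have "Int_stable (sets (vimage_algebra (space M) V borel))"
    by (rule sets.Int_stable)
  ultimately have "indep_set (sigma_sets (space M) ?G)
      (sigma_sets (space M) (sets (vimage_algebra (space M) V borel)))"
    by (rule indep_set_sigma_sets)
  then show ?thesis
    unfolding indep_random_vars_def U_sets
    using sets.sigma_sets_eq[of "vimage_algebra (space M) V borel"] by simp
qed

section \<open>The probability integral transform\<close>

text \<open>For \<open>0 < c < 1\<close> the sublevel set of the continuous monotone function \<open>cdf M\<close> is a closed
  half-line with right endpoint \<open>s\<close>, and \<open>cdf M s = c\<close> by the intermediate value theorem. The value
  \<open>0\<close> may not be attained, so \<open>c = 0\<close> is handled as a limit.\<close>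

lemma (in real_distribution) prob_cdf_le:
  assumes cont: "continuous_on UNIV (cdf M)" and "0 \<le> c" "c \<le> 1"
  shows "measure M {y. cdf M y \<le> c} = c"
proof -
  have meas [measurable]: "cdf M \<in> borel_measurable borel"
    using cont by (rule borel_measurable_continuous_onI)
  have interior: "measure M {y. cdf M y \<le> c} = c" if c: "0 < c" "c < 1" for c
  proof -
    let ?S = "{y. cdf M y \<le> c}"
    have "\<forall>\<^sub>F y in at_bot. cdf M y < c" "\<forall>\<^sub>F y in at_top. c < cdf M y"
      using c order_tendstoD[OF cdf_lim_at_bot] order_tendstoD[OF cdf_lim_at_top_prob] by auto
    then obtain a b where a: "cdf M a < c" and b: "c < cdf M b"
      by (metis eventually_at_bot_linorder eventually_at_top_linorder order_refl)
    have "a \<le> b"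
      using a b cdf_nondecreasing[of b a] by linarith
    then obtain z where z: "cdf M z = c"
      using IVT'[of "cdf M" a c b] a b continuous_on_subset[OF cont] by auto
    have bdd: "y \<le> b" if "y \<in> ?S" for y
      using that b cdf_nondecreasing[of b y] by (cases "y \<le> b") auto
    then have bdd_S: "bdd_above ?S"
      by (rule bdd_aboveI)
    have "closed ?S"
      using cont by (intro closed_Collect_le continuous_on_const)
    then have Sup: "Sup ?S \<in> ?S"
      using z by (intro closed_contains_Sup bdd_S) auto
    have "?S = {..Sup ?S}"
    proof (intro set_eqI iffI)
      show "y \<in> {..Sup ?S}" if "y \<in> ?S" for y
        using cSup_upper[OF that bdd_S] by simp
      show "y \<in> ?S" if "y \<in> {..Sup ?S}" for y
        using that Sup cdf_nondecreasing[of y "Sup ?S"] by simp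
    qed
    moreover have "cdf M (Sup ?S) = c"
      using Sup cSup_upper[OF _ bdd_S, of z] z cdf_nondecreasing[of z "Sup ?S"] by simp
    ultimately show ?thesis
      by (simp only: cdf_def2)
  qed
  consider "c = 0" | "0 < c" "c < 1" | "c = 1"
    using assms by linarith
  then show ?thesis
  proof cases
    case 1
    have "measure M {y. cdf M y \<le> 0} \<le> e" if "0 < e" for e
    proof -
      have "measure M {y. cdf M y \<le> 0} \<le> measure M {y. cdf M y \<le> min e (1/2)}"
        using that by (intro finite_measure_mono) auto
      also have "\<dots> = min e (1/2)"
        using that by (intro interior) auto
      finally show ?thesis
        by simp
    qed
    then show ?thesis
      using 1 measure_nonneg[of M "{y. cdf M y \<le> 0}"] field_le_epsilon[of "measure M {y. cdf M y \<le> 0}" 0]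
      by (simp add: measure_le_0_iff)
  next
    case 3
    then show ?thesis
      using prob_space cdf_bounded_prob by simp
  qed (rule interior)
qed

lemma (in real_distribution) distributed_cdf_uniform:
  assumes cont: "continuous_on UNIV (cdf M)"
  shows "distributed M lborel (cdf M) (\<lambda>u. ennreal (indicator {0..1} u))"
proof -
  have [measurable]: "cdf M \<in> borel_measurable borel"
    using cont by (rule borel_measurable_continuous_onI)
  have "distributed M lborel (cdf M) (\<lambda>x. indicator {0..1} x / measure lborel {0..1::real})"
    by (rule uniform_distrI_borel_atLeastAtMost) (auto simp: prob_cdf_le cont)
  then show ?thesis
    by simp
qed

text \<open>For fixed \<open>x\<close> with \<open>u = cdf M x\<close>, the section of the event has probability
  \<open>max 0 (u - t)\<close>. Its integral over the uniform variable \<open>u\<close> is the area of the triangle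
  with legs \<open>1 - t\<close>.\<close>

lemma (in real_distribution) pair_prob_cdf_gap:
  assumes cont: "continuous_on UNIV (cdf M)" and t: "0 \<le> t" "t \<le> 1"
  shows "\<P>(p in M \<Otimes>\<^sub>M M. t < cdf M (fst p) - cdf M (snd p)) = (1 - t)\<^sup>2 / 2"
proof -
  interpret P: pair_prob_space M M ..
  have [measurable]: "cdf M \<in> borel_measurable M"
    using cont by (simp add: borel_measurable_continuous_onI)
  have lt: "emeasure M {y. cdf M y < c} = ennreal (max 0 c)" if "c \<le> 1" for c
  proof -
    have "emeasure M (cdf M -` {..<c} \<inter> space M) =
        (\<integral>\<^sup>+u. ennreal (indicator {0..1} u) * indicator {..<c} u \<partial>lborel)"
      by (rule distributed_emeasure[OF distributed_cdf_uniform[OF cont]]) auto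
    also have "\<dots> = (\<integral>\<^sup>+u. indicator {0..<c} u \<partial>lborel)"
      using that by (intro nn_integral_cong) (auto simp: indicator_def)
    also have "\<dots> = ennreal (max 0 c)"
      by (cases "0 \<le> c") (auto simp: max_def)
    finally show ?thesis
      by (simp add: vimage_def)
  qed
  let ?L = "{p \<in> space (M \<Otimes>\<^sub>M M). t < cdf M (fst p) - cdf M (snd p)}"
  have "emeasure (M \<Otimes>\<^sub>M M) ?L = (\<integral>\<^sup>+x. emeasure M (Pair x -` ?L) \<partial>M)"
    by (rule emeasure_pair_measure_alt) measurable
  also have "\<dots> = (\<integral>\<^sup>+x. ennreal (max 0 (cdf M x - t)) \<partial>M)"
  proof (rule nn_integral_cong)
    fix x
    have "Pair x -` ?L = {y. cdf M y < cdf M x - t}"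
      by (auto simp: space_pair_measure)
    then show "emeasure M (Pair x -` ?L) = ennreal (max 0 (cdf M x - t))"
      using lt[of "cdf M x - t"] t cdf_bounded_prob[of x] by simp
  qed
  also have "\<dots> = (\<integral>\<^sup>+u. ennreal (indicator {0..1} u) * ennreal (max 0 (u - t)) \<partial>lborel)"
    by (rule distributed_nn_integral[OF distributed_cdf_uniform[OF cont], symmetric]) simp
  also have "\<dots> = (\<integral>\<^sup>+u. ennreal (u - t) * indicator {t..1} u \<partial>lborel)"
    using t by (intro nn_integral_cong) (auto simp: indicator_def max_def ennreal_neg)
  also have "\<dots> = ennreal ((1 - t)\<^sup>2 / 2 - (t - t)\<^sup>2 / 2)"
    by (rule nn_integral_FTC_Icc) (use t in \<open>auto intro!: derivative_eq_intros\<close>)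
  finally show ?thesis
    by (simp add: measure_def)
qed

text \<open>The complement consists of two triangles that the coordinate swap exchanges.\<close>

lemma (in real_distribution) pair_prob_cdf_diff_le:
  assumes cont: "continuous_on UNIV (cdf M)" and t: "0 \<le> t" "t \<le> 1"
  shows "\<P>(p in M \<Otimes>\<^sub>M M. \<bar>cdf M (fst p) - cdf M (snd p)\<bar> \<le> t) = 2 * t - t\<^sup>2"
proof -
  interpret P: pair_prob_space M M ..
  have [measurable]: "cdf M \<in> borel_measurable M"
    using cont by (simp add: borel_measurable_continuous_onI)
  let ?L = "{p \<in> space (M \<Otimes>\<^sub>M M). t < cdf M (fst p) - cdf M (snd p)}"
    and ?R = "{p \<in> space (M \<Otimes>\<^sub>M M). t < cdf M (snd p) - cdf M (fst p)}"
  have L: "?L \<in> sets (M \<Otimes>\<^sub>M M)"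
    by measurable
  have R: "?R \<in> sets (M \<Otimes>\<^sub>M M)"
    by measurable
  have "measure (M \<Otimes>\<^sub>M M) ?R = measure (distr (M \<Otimes>\<^sub>M M) (M \<Otimes>\<^sub>M M) (\<lambda>(x, y). (y, x))) ?R"
    by (subst (1) P.distr_pair_swap) (rule refl)
  also have "\<dots> = measure (M \<Otimes>\<^sub>M M) ((\<lambda>(x, y). (y, x)) -` ?R \<inter> space (M \<Otimes>\<^sub>M M))"
    by (rule measure_distr[OF measurable_pair_swap' R])
  also have "(\<lambda>(x, y). (y, x)) -` ?R \<inter> space (M \<Otimes>\<^sub>M M) = ?L"
    by (auto simp: space_pair_measure)
  finally have "measure (M \<Otimes>\<^sub>M M) ?R = measure (M \<Otimes>\<^sub>M M) ?L" .
  moreover have disj: "?L \<inter> ?R = {}"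
    using t by auto
  ultimately have union: "measure (M \<Otimes>\<^sub>M M) (?L \<union> ?R) = (1 - t)\<^sup>2"
    using pair_prob_cdf_gap[OF cont t] P.P.finite_measure_Union[OF L R disj] by linarith
  have compl: "{p \<in> space (M \<Otimes>\<^sub>M M). \<bar>cdf M (fst p) - cdf M (snd p)\<bar> \<le> t} =
      space (M \<Otimes>\<^sub>M M) - (?L \<union> ?R)"
    by auto
  have "\<P>(p in M \<Otimes>\<^sub>M M. \<bar>cdf M (fst p) - cdf M (snd p)\<bar> \<le> t) = 1 - (1 - t)\<^sup>2"
    unfolding compl P.P.prob_compl[OF sets.Un[OF L R]] union ..
  then show ?thesis
    by (simp add: power2_eq_square algebra_simps)
qed

section \<open>The mean gap between two variables with a common law\<close>

text \<open>Since \<open>D\<close> has no atoms, \<open>\<bar>cdf D u - cdf D v\<bar>\<close> is the \<open>D\<close>-measure of the set of thresholds \<open>y\<close>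
  for which exactly one of \<open>u \<le> y\<close> and \<open>v \<le> y\<close> holds. Integrating the indicator of this event
  (the function \<open>f\<close> below) in both orders gives the formula.\<close>

lemma (in prob_space) expectation_cdf_diff:
  fixes U V :: "'a \<Rightarrow> real"
  assumes D: "real_distribution D" and cont: "continuous_on UNIV (cdf D)"
    and U [measurable]: "U \<in> borel_measurable M" and V [measurable]: "V \<in> borel_measurable M"
    and U_law: "distr M borel U = D" and V_law: "distr M borel V = D"
  shows "expectation (\<lambda>\<omega>. \<bar>cdf D (U \<omega>) - cdf D (V \<omega>)\<bar>) =
    2 * (\<integral>y. cdf D y - \<P>(\<omega> in M. U \<omega> \<le> y \<and> V \<omega> \<le> y) \<partial>D)"
proof -
  interpret D: real_distribution D by fact
  interpret P: pair_prob_space M D ..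
  define f :: "'a \<Rightarrow> real \<Rightarrow> real"
    where "f \<omega> y = indicator {U \<omega>..} y + indicator {V \<omega>..} y - 2 * indicator {max (U \<omega>) (V \<omega>)..} y" for \<omega> y
  have tail: "measure D {u..} = 1 - cdf D u" for u
  proof -
    have "isCont (cdf D) u"
      using cont by (simp add: continuous_on_eq_continuous_at)
    then have "measure D {u} = 0"
      by (simp add: D.isCont_cdf)
    moreover have "measure D ({u} \<union> {u<..}) = measure D {u} + measure D {u<..}"
      by (rule D.finite_measure_Union) auto
    moreover have "{u} \<union> {u<..} = {u..}" "{u<..} = space D - {..u}"
      by auto
    ultimately show ?thesis
      using D.prob_compl[of "{..u}"] by (simp add: cdf_def)
  qed
  have inner_D: "(\<integral>y. f \<omega> y \<partial>D) = \<bar>cdf D (U \<omega>) - cdf D (V \<omega>)\<bar>" for \<omega>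
  proof -
    have "(\<integral>y. f \<omega> y \<partial>D) =
        measure D {U \<omega>..} + measure D {V \<omega>..} - 2 * measure D {max (U \<omega>) (V \<omega>)..}"
      unfolding f_def by (simp add: D.emeasure_eq_measure)
    also have "\<dots> = \<bar>cdf D (U \<omega>) - cdf D (V \<omega>)\<bar>"
      using D.cdf_nondecreasing[of "U \<omega>" "V \<omega>"] D.cdf_nondecreasing[of "V \<omega>" "U \<omega>"]
      by (auto simp: tail max_def)
    finally show ?thesis .
  qed
  have cdf_U: "prob {\<omega> \<in> space M. U \<omega> \<le> y} = cdf D y" for y
    unfolding U_law[symmetric] cdf_def by (simp add: measure_distr vimage_def Int_def conj_commute)
  have cdf_V: "prob {\<omega> \<in> space M. V \<omega> \<le> y} = cdf D y" for y
    unfolding V_law[symmetric] cdf_def by (simp add: measure_distr vimage_def Int_def conj_commute)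
  have inner_M: "(\<integral>\<omega>. f \<omega> y \<partial>M) = 2 * (cdf D y - \<P>(\<omega> in M. U \<omega> \<le> y \<and> V \<omega> \<le> y))" for y
  proof -
    have "(\<integral>\<omega>. f \<omega> y \<partial>M) = (\<integral>\<omega>. indicator {\<omega> \<in> space M. U \<omega> \<le> y} \<omega> +
        indicator {\<omega> \<in> space M. V \<omega> \<le> y} \<omega> - 2 * indicator {\<omega> \<in> space M. U \<omega> \<le> y \<and> V \<omega> \<le> y} \<omega> \<partial>M)"
      unfolding f_def by (intro Bochner_Integration.integral_cong) (auto simp: indicator_def)
    also have "\<dots> = prob {\<omega> \<in> space M. U \<omega> \<le> y} + prob {\<omega> \<in> space M. V \<omega> \<le> y} -
        2 * \<P>(\<omega> in M. U \<omega> \<le> y \<and> V \<omega> \<le> y)"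
      by (simp add: emeasure_eq_measure)
    finally show ?thesis
      by (simp add: cdf_U cdf_V)
  qed
  have f_eq: "f = (\<lambda>\<omega> y. (if U \<omega> \<le> y then 1 else 0) + (if V \<omega> \<le> y then 1 else 0) -
      2 * (if U \<omega> \<le> y \<and> V \<omega> \<le> y then 1 else 0))"
    by (auto simp: f_def fun_eq_iff indicator_def)
  have "integrable (M \<Otimes>\<^sub>M D) (case_prod f)"
  proof (rule P.integrable_const_bound[where B=2])
    show "case_prod f \<in> borel_measurable (M \<Otimes>\<^sub>M D)"
      unfolding f_eq by measurable
    show "AE x in M \<Otimes>\<^sub>M D. norm (case_prod f x) \<le> 2"
      unfolding f_eq by (intro AE_I2) auto
  qed
  then have "(\<integral>y. (\<integral>\<omega>. f \<omega> y \<partial>M) \<partial>D) = (\<integral>\<omega>. (\<integral>y. f \<omega> y \<partial>D) \<partial>M)"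
    by (rule P.Fubini_integral)
  then show ?thesis
    unfolding inner_D inner_M by (simp only: integral_mult_right_zero)
qed

text \<open>Under the product measure the joint distribution function on the diagonal is the square of
  the marginal one.\<close>

lemma (in real_distribution) pair_expectation_cdf_diff:
  assumes cont: "continuous_on UNIV (cdf M)"
  shows "(\<integral>p. \<bar>cdf M (fst p) - cdf M (snd p)\<bar> \<partial>(M \<Otimes>\<^sub>M M)) = 2 * (\<integral>y. cdf M y - (cdf M y)\<^sup>2 \<partial>M)"
proof -
  interpret P: pair_prob_space M M ..
  have D: "real_distribution M" ..
  have fst_law: "distr (M \<Otimes>\<^sub>M M) borel fst = M"
    using distr_pair_fst[of M] by (simp cong: distr_cong)
  have snd_law: "distr (M \<Otimes>\<^sub>M M) borel snd = M"
  proof -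
    have "distr (M \<Otimes>\<^sub>M M) borel snd =
        distr (distr (M \<Otimes>\<^sub>M M) (M \<Otimes>\<^sub>M M) (\<lambda>(x, y). (y, x))) borel snd"
      by (subst (1) P.distr_pair_swap) (rule refl)
    also have "\<dots> = distr (M \<Otimes>\<^sub>M M) borel fst"
      by (subst distr_distr) (auto simp: comp_def split_beta)
    finally show ?thesis
      by (simp add: fst_law)
  qed
  have "\<P>(p in M \<Otimes>\<^sub>M M. fst p \<le> y \<and> snd p \<le> y) = (cdf M y)\<^sup>2" for y
  proof -
    have "{p \<in> space (M \<Otimes>\<^sub>M M). fst p \<le> y \<and> snd p \<le> y} = {..y} \<times> {..y}"
      by (auto simp: space_pair_measure)
    then have "\<P>(p in M \<Otimes>\<^sub>M M. fst p \<le> y \<and> snd p \<le> y) = measure M {..y} * measure M {..y}"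
      by (simp add: measure_def emeasure_pair_measure_Times enn2real_mult)
    then show ?thesis
      by (simp add: cdf_def power2_eq_square)
  qed
  then show ?thesis
    using P.P.expectation_cdf_diff[OF D cont _ _ fst_law snd_law] by simp
qed

text \<open>The support of \<open>M\<close> may have gaps, so continuity of \<open>h\<close> alone would not suffice. However, \<open>h\<close> is
  constant wherever \<open>cdf M\<close> is, and to the left of \<open>y\<close> there is positive mass on which \<open>cdf M\<close> is
  arbitrarily close to \<open>cdf M y\<close>, unless \<open>cdf M y = 0\<close>.\<close>

lemma (in real_distribution) eq_0_if_AE_eq_0_and_cdf_Lipschitz:
  fixes h :: "real \<Rightarrow> real"
  assumes cont: "continuous_on UNIV (cdf M)"
    and "0 < K" and AE: "AE x in M. h x = 0"
    and Lipschitz: "\<And>x y. x \<le> y \<Longrightarrow> \<bar>h y - h x\<bar> \<le> K * (cdf M y - cdf M x)"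
    and left: "\<And>y. cdf M y = 0 \<Longrightarrow> h y = 0"
  shows "h y = 0"
proof (cases "cdf M y = 0")
  case True
  then show ?thesis
    by (rule left)
next
  case False
  have "\<bar>h y\<bar> \<le> 0 + e" if "0 < e" for e
  proof -
    have "0 < cdf M y"
      using False cdf_nonneg[of y] by simp
    then have "\<forall>\<^sub>F z in at_bot. cdf M z < cdf M y"
      by (rule order_tendstoD[OF cdf_lim_at_bot])
    then obtain a where a: "cdf M a < cdf M y"
      using eventually_happens'[OF trivial_limit_at_bot_linorder] by blast
    \<comment> \<open>Within \<open>e / K\<close> of \<open>cdf M y\<close> the function \<open>h\<close> moves by at most \<open>e\<close>; the maximum with \<open>cdf M a\<close>
      keeps \<open>c\<close> in the range of \<open>cdf M\<close>.\<close>
    define c where "c = max (cdf M a) (cdf M y - e / K)"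
    have c: "cdf M a \<le> c" "c < cdf M y" "cdf M y - e / K \<le> c"
      using a \<open>0 < e\<close> \<open>0 < K\<close> by (auto simp: c_def)
    have "a \<le> y"
      using a cdf_nondecreasing[of y a] by linarith
    then obtain z where z: "cdf M z = c" "z \<le> y"
      using IVT'[of "cdf M" a c y] c continuous_on_subset[OF cont] by auto
    then have "z < y"
      using c by (cases "z = y") auto
    have "\<exists>x\<in>{z<..y}. h x = 0"
    proof (rule ccontr)
      assume no_zero: "\<not> (\<exists>x\<in>{z<..y}. h x = 0)"
      have "AE x in M. x \<notin> {z<..y}"
        using AE by eventually_elim (use no_zero in auto)
      then have "measure M {z<..y} = 0"
        by (subst prob_eq_0) simp_all
      then show False
        using cdf_diff_eq[OF \<open>z < y\<close>] z c by simp
    qed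
    then obtain x where x: "z < x" "x \<le> y" "h x = 0"
      by auto
    have "\<bar>h y\<bar> \<le> K * (cdf M y - cdf M x)"
      using Lipschitz[OF \<open>x \<le> y\<close>] x by simp
    also have "\<dots> \<le> K * (e / K)"
      using c z x cdf_nondecreasing[of z x] \<open>0 < K\<close> by (intro mult_left_mono) auto
    finally show ?thesis
      using \<open>0 < K\<close> by simp
  qed
  then have "\<bar>h y\<bar> \<le> 0"
    by (rule field_le_epsilon)
  then show ?thesis
    by simp
qed

text \<open>The assumed distribution function of the gap is that of the independent case, so the means
  agree, and \<open>expectation_cdf_diff\<close> turns this into the vanishing of the integral of a nonnegative
  function. The marginals bound the increments of the joint distribution function by those
  of \<open>cdf D\<close>, which extends the equality from almost every \<open>y\<close> to every \<open>y\<close>.\<close>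

lemma (in prob_space) joint_cdf_eq_square:
  fixes U V :: "'a \<Rightarrow> real"
  assumes D: "real_distribution D" and cont: "continuous_on UNIV (cdf D)"
    and U [measurable]: "U \<in> borel_measurable M" and V [measurable]: "V \<in> borel_measurable M"
    and U_law: "distr M borel U = D" and V_law: "distr M borel V = D"
    and gap_law: "\<And>t. 0 \<le> t \<Longrightarrow> t \<le> 1 \<Longrightarrow>
      \<P>(\<omega> in M. \<bar>cdf D (U \<omega>) - cdf D (V \<omega>)\<bar> \<le> t) = 2 * t - t\<^sup>2"
    and pos_dep: "\<And>y. (cdf D y)\<^sup>2 \<le> \<P>(\<omega> in M. U \<omega> \<le> y \<and> V \<omega> \<le> y)"
  shows "\<P>(\<omega> in M. U \<omega> \<le> y \<and> V \<omega> \<le> y) = (cdf D y)\<^sup>2"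
proof -
  interpret D: real_distribution D by fact
  interpret P: pair_prob_space D D ..
  let ?F = "cdf D"
  have F_meas [measurable]: "?F \<in> borel_measurable borel"
    using cont by (rule borel_measurable_continuous_onI)
  have F_01: "0 \<le> ?F y" "?F y \<le> 1" for y
    by (auto simp: D.cdf_nonneg D.cdf_bounded_prob)
  define G where "G y = \<P>(\<omega> in M. U \<omega> \<le> y \<and> V \<omega> \<le> y)" for y
  have "mono G"
    unfolding G_def by (intro monoI finite_measure_mono) auto
  then have G_meas [measurable]: "G \<in> borel_measurable borel"
    by (rule borel_measurable_mono)
  have G_int: "integrable D G"
    by (rule D.integrable_const_bound[where B=1]) (auto simp: G_def)
  have F_int: "integrable D ?F" and F2_int: "integrable D (\<lambda>y. (?F y)\<^sup>2)"
    using F_01 by (auto intro!: D.integrable_const_bound[where B=1] simp: power_le_one)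

  let ?gap = "\<lambda>\<omega>. \<bar>?F (U \<omega>) - ?F (V \<omega>)\<bar>" and ?gap2 = "\<lambda>p. \<bar>?F (fst p) - ?F (snd p)\<bar>"
  have F_DD [measurable]: "?F \<in> borel_measurable D"
    by simp
  have "distr M borel ?gap = distr (D \<Otimes>\<^sub>M D) borel ?gap2"
  proof (rule cdf_unique)
    show "real_distribution (distr M borel ?gap)"
      by (rule real_distribution_distr) measurable
    show "real_distribution (distr (D \<Otimes>\<^sub>M D) borel ?gap2)"
      by (rule P.P.real_distribution_distr) measurable
    show "cdf (distr M borel ?gap) = cdf (distr (D \<Otimes>\<^sub>M D) borel ?gap2)"
    proof
      fix t :: real
      have L: "cdf (distr M borel ?gap) t = \<P>(\<omega> in M. ?gap \<omega> \<le> t)"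
        unfolding cdf_def[of "distr M borel ?gap"]
          by (subst measure_distr) (auto intro!: arg_cong[where f=prob])
      have R: "cdf (distr (D \<Otimes>\<^sub>M D) borel ?gap2) t = \<P>(p in D \<Otimes>\<^sub>M D. ?gap2 p \<le> t)"
        unfolding cdf_def[of "distr (D \<Otimes>\<^sub>M D) borel ?gap2"]
          by (subst measure_distr) (auto intro!: arg_cong[where f=P.P.prob])
      consider "t < 0" | "0 \<le> t" "t \<le> 1" | "1 < t"
        by linarith
      then show "cdf (distr M borel ?gap) t = cdf (distr (D \<Otimes>\<^sub>M D) borel ?gap2) t"
      proof cases
        case 1
        then have "\<not> \<bar>x\<bar> \<le> t" for x
          by linarith
        then show ?thesis
          unfolding L R by simp
      next
        case 2
        then show ?thesis
          unfolding L R by (simp add: gap_law D.pair_prob_cdf_diff_le[OF cont])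
      next
        case 3
        have "\<bar>?F x - ?F y\<bar> \<le> t" for x y
          using 3 F_01[of x] F_01[of y] by linarith
        then show ?thesis
          unfolding L R using prob_space P.P.prob_space by simp
      qed
    qed
  qed
  then have "(\<integral>x. x \<partial>distr M borel ?gap) = (\<integral>x. x \<partial>distr (D \<Otimes>\<^sub>M D) borel ?gap2)"
    by (rule arg_cong)
  moreover have "(\<integral>x. x \<partial>distr M borel ?gap) = expectation ?gap"
    by (rule integral_distr) measurable
  moreover have "(\<integral>x. x \<partial>distr (D \<Otimes>\<^sub>M D) borel ?gap2) = P.P.expectation ?gap2"
    by (rule integral_distr) measurable
  moreover have "expectation ?gap = 2 * (\<integral>y. ?F y - G y \<partial>D)"
    unfolding G_def by (rule expectation_cdf_diff) fact+
  moreover have "P.P.expectation ?gap2 = 2 * (\<integral>y. ?F y - (?F y)\<^sup>2 \<partial>D)"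
    by (rule D.pair_expectation_cdf_diff[OF cont])
  ultimately have "(\<integral>y. ?F y - G y \<partial>D) = (\<integral>y. ?F y - (?F y)\<^sup>2 \<partial>D)"
    by linarith
  then have "(\<integral>y. G y - (?F y)\<^sup>2 \<partial>D) = 0"
    using G_int F_int F2_int by (simp add: Bochner_Integration.integral_diff)
  moreover have "integrable D (\<lambda>y. G y - (?F y)\<^sup>2)"
    using G_int F2_int by (rule Bochner_Integration.integrable_diff)
  moreover have "AE y in D. 0 \<le> G y - (?F y)\<^sup>2"
    using pos_dep by (simp add: G_def)
  ultimately have AE: "AE y in D. G y - (?F y)\<^sup>2 = 0"
    using integral_nonneg_eq_0_iff_AE[of D "\<lambda>y. G y - (?F y)\<^sup>2"] by simp

  have prob_U: "prob (U -` A \<inter> space M) = measure D A" if "A \<in> sets borel" for A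
    using that measure_distr[OF U that] by (simp add: U_law)
  have prob_V: "prob (V -` A \<inter> space M) = measure D A" if "A \<in> sets borel" for A
    using that measure_distr[OF V that] by (simp add: V_law)
  have G_diff: "G z - G x \<le> 2 * (?F z - ?F x)" if "x \<le> z" for x z
  proof -
    have "G z \<le> prob ({\<omega> \<in> space M. U \<omega> \<le> x \<and> V \<omega> \<le> x} \<union>
        (U -` {x<..z} \<inter> space M \<union> V -` {x<..z} \<inter> space M))"
      unfolding G_def by (intro finite_measure_mono) auto
    also have "\<dots> \<le> G x + (prob (U -` {x<..z} \<inter> space M) + prob (V -` {x<..z} \<inter> space M))"
      unfolding G_def
      by (intro order_trans[OF measure_Un_le] add_mono order_refl) auto
    also have "\<dots> = G x + 2 * measure D {x<..z}"
      by (simp add: prob_U prob_V)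
    also have "measure D {x<..z} = ?F z - ?F x"
      using D.cdf_diff_eq[of x z] that by (cases "x = z") auto
    finally show ?thesis
      by simp
  qed
  have "G y - (?F y)\<^sup>2 = 0"
  proof (rule D.eq_0_if_AE_eq_0_and_cdf_Lipschitz[OF cont _ AE])
    show "(0::real) < 4"
      by simp
    show "\<bar>(G z - (?F z)\<^sup>2) - (G x - (?F x)\<^sup>2)\<bar> \<le> 4 * (?F z - ?F x)" if "x \<le> z" for x z
    proof -
      have "(?F z)\<^sup>2 - (?F x)\<^sup>2 = (?F z + ?F x) * (?F z - ?F x)"
        by (simp add: power2_eq_square algebra_simps)
      moreover have "0 \<le> (?F z + ?F x) * (?F z - ?F x)"
        "(?F z + ?F x) * (?F z - ?F x) \<le> 2 * (?F z - ?F x)"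
        using F_01[of z] F_01[of x] D.cdf_nondecreasing[OF that]
          mult_right_mono[of "?F z + ?F x" 2 "?F z - ?F x"] by simp_all
      moreover have "G x \<le> G z"
        using \<open>mono G\<close> that by (rule monoD)
      ultimately show ?thesis
        using G_diff[OF that] D.cdf_nondecreasing[OF that] by linarith
    qed
    show "G z - (?F z)\<^sup>2 = 0" if "?F z = 0" for z
    proof -
      have "G z \<le> prob (U -` {..z} \<inter> space M)"
        unfolding G_def by (intro finite_measure_mono) auto
      then have "G z \<le> 0"
        using that by (simp add: prob_U cdf_def)
      then show ?thesis
        using that by (simp add: G_def measure_le_0_iff)
    qed
  qed
  then show ?thesis
    by (simp add: G_def)
qed

section \<open>Conditionally independent copies\<close>

locale cond_iid_pair = prob_space M
  for M :: "'a measure" and W :: "'a \<Rightarrow> 'c::topological_space" and Y Y' :: "'a \<Rightarrow> real" +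
  assumes W_meas: "W \<in> borel_measurable M"
    and Y_meas [measurable]: "Y \<in> borel_measurable M"
    and copy: "cond_iid_copy M W Y Y'"
begin

abbreviation (input) "cond_law A \<equiv> cond_prob_given M W {\<omega> \<in> space M. Y \<omega> \<in> A}"

lemma Y'_meas [measurable]: "Y' \<in> borel_measurable M"
  using copy by (simp add: cond_iid_copy_def)

lemma sets_vimage_W: "sets (vimage_algebra (space M) W borel) = {W -` B \<inter> space M | B. B \<in> sets borel}"
  by (simp add: sets_vimage_algebra2)

lemma subalgebra_W: "subalgebra M (vimage_algebra (space M) W borel)"
  using measurable_sets[OF W_meas] by (auto simp: subalgebra_def sets_vimage_W)

sublocale W: sigma_finite_subalgebra M "vimage_algebra (space M) W borel"
proof -
  interpret finite_measure_subalgebra M "vimage_algebra (space M) W borel"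
    using subalgebra_W by unfold_locales
  show "sigma_finite_subalgebra M (vimage_algebra (space M) W borel)"
    by (rule sigma_finite_subalgebra_axioms)
qed

lemma integrable_indicator_event: "E \<in> events \<Longrightarrow> integrable M (indicator E :: 'a \<Rightarrow> real)"
  by (simp add: emeasure_eq_measure)

lemma cond_prob_measurable [measurable]: "cond_prob_given M W E \<in> borel_measurable M"
  unfolding cond_prob_given_def by (rule borel_measurable_cond_exp2)

lemma cond_prob_integrable: "E \<in> events \<Longrightarrow> integrable M (cond_prob_given M W E)"
  unfolding cond_prob_given_def by (intro W.real_cond_exp_int integrable_indicator_event)

lemma integral_cond_prob: "E \<in> events \<Longrightarrow> (\<integral>\<omega>. cond_prob_given M W E \<omega> \<partial>M) = prob E"
  unfolding cond_prob_given_def by (simp add: W.real_cond_exp_int integrable_indicator_event)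

lemma cond_prob_bounds:
  assumes "E \<in> events"
  shows "AE \<omega> in M. 0 \<le> cond_prob_given M W E \<omega> \<and> cond_prob_given M W E \<omega> \<le> 1"
  using W.real_cond_exp_ge_c[OF integrable_indicator_event[OF assms], of 0]
    W.real_cond_exp_le_c[OF integrable_indicator_event[OF assms], of 1]
  unfolding cond_prob_given_def by (auto simp: indicator_def)

lemma prob_Int_W:
  assumes E: "E \<in> events" and B: "B \<in> sets borel"
  shows "prob (E \<inter> (W -` B \<inter> space M)) =
    (\<integral>\<omega>. indicator (W -` B \<inter> space M) \<omega> * cond_prob_given M W E \<omega> \<partial>M)"
proof -
  let ?V = "W -` B \<inter> space M"
  have V: "?V \<in> sets (vimage_algebra (space M) W borel)"
    using B by (auto simp: sets_vimage_W)
  have "?V \<in> events"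
    using measurable_sets[OF W_meas B] .
  then have "prob (E \<inter> ?V) = (\<integral>\<omega>. indicator ?V \<omega> * indicator E \<omega> \<partial>M)"
    using E by (simp add: indicator_inter_arith[symmetric] Int_commute)
  also have "\<dots> = (\<integral>\<omega>\<in>?V. indicator E \<omega> \<partial>M)"
    by (simp add: set_lebesgue_integral_def)
  also have "\<dots> = (\<integral>\<omega>\<in>?V. cond_prob_given M W E \<omega> \<partial>M)"
    unfolding cond_prob_given_def
    by (rule W.real_cond_exp_intA[OF integrable_indicator_event[OF E] V])
  finally show ?thesis
    by (simp add: set_lebesgue_integral_def)
qed

text \<open>This is the mean of the defining product formula for the conditional probabilities.\<close>

lemma joint_prob:
  assumes [measurable]: "A \<in> sets borel" "B \<in> sets borel"
  shows "\<P>(\<omega> in M. Y \<omega> \<in> A \<and> Y' \<omega> \<in> B) = (\<integral>\<omega>. cond_law A \<omega> * cond_law B \<omega> \<partial>M)"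
proof -
  have "\<P>(\<omega> in M. Y \<omega> \<in> A \<and> Y' \<omega> \<in> B) =
      (\<integral>\<omega>. cond_prob_given M W {\<omega> \<in> space M. Y \<omega> \<in> A \<and> Y' \<omega> \<in> B} \<omega> \<partial>M)"
    by (rule integral_cond_prob[symmetric]) measurable
  also have "\<dots> = (\<integral>\<omega>. cond_law A \<omega> * cond_law B \<omega> \<partial>M)"
    using copy assms by (intro integral_cong_AE) (auto simp: cond_iid_copy_def)
  finally show ?thesis .
qed

text \<open>Take \<open>A = UNIV\<close> in the product formula: the first factor is almost surely \<open>1\<close>.\<close>

lemma copy_law: "distr M borel Y' = distr M borel Y"
proof (rule measure_eqI)
  fix B assume "B \<in> sets (distr M borel Y')"
  then have B [measurable]: "B \<in> sets borel"
    by simp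
  have "space M \<in> sets (vimage_algebra (space M) W borel)"
    by (metis sets.top space_vimage_algebra)
  then have "AE \<omega> in M. cond_prob_given M W (space M) \<omega> = indicator (space M) \<omega>"
    unfolding cond_prob_given_def
    by (intro W.real_cond_exp_F_meas integrable_indicator_event borel_measurable_indicator) auto
  moreover have "{\<omega> \<in> space M. Y \<omega> \<in> UNIV} = space M"
    by simp
  ultimately have "AE \<omega> in M. cond_law UNIV \<omega> = indicator (space M) \<omega>"
    by (simp only:)
  then have one: "AE \<omega> in M. cond_law UNIV \<omega> = 1"
    using AE_space by eventually_elim simp
  have "prob (Y' -` B \<inter> space M) = \<P>(\<omega> in M. Y \<omega> \<in> UNIV \<and> Y' \<omega> \<in> B)"
    by (intro arg_cong[where f=prob]) auto
  also have "\<dots> = (\<integral>\<omega>. cond_law UNIV \<omega> * cond_law B \<omega> \<partial>M)"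
    by (rule joint_prob) auto
  also have "\<dots> = (\<integral>\<omega>. cond_law B \<omega> \<partial>M)"
    using one by (intro integral_cong_AE) auto
  also have "\<dots> = prob {\<omega> \<in> space M. Y \<omega> \<in> B}"
    by (rule integral_cond_prob) measurable
  also have "{\<omega> \<in> space M. Y \<omega> \<in> B} = Y -` B \<inter> space M"
    by auto
  finally show "emeasure (distr M borel Y') B = emeasure (distr M borel Y) B"
    by (simp add: emeasure_distr emeasure_eq_measure)
qed simp

text \<open>The second moment of the conditional probability of \<open>A\<close> is the probability that both the
  variable and its copy lie in \<open>A\<close>; this is where positive dependence between them comes from.\<close>

lemma cond_law_variance:
  assumes A [measurable]: "A \<in> sets borel"
  shows "integrable M (\<lambda>\<omega>. (cond_law A \<omega> - \<P>(\<omega> in M. Y \<omega> \<in> A))\<^sup>2)"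
    and "(\<integral>\<omega>. (cond_law A \<omega> - \<P>(\<omega> in M. Y \<omega> \<in> A))\<^sup>2 \<partial>M) =
      \<P>(\<omega> in M. Y \<omega> \<in> A \<and> Y' \<omega> \<in> A) - (\<P>(\<omega> in M. Y \<omega> \<in> A))\<^sup>2"
proof -
  let ?c = "\<P>(\<omega> in M. Y \<omega> \<in> A)" and ?p = "cond_law A"
  have E: "{\<omega> \<in> space M. Y \<omega> \<in> A} \<in> events"
    by measurable
  have int: "integrable M ?p"
    by (rule cond_prob_integrable[OF E])
  have int2: "integrable M (\<lambda>\<omega>. ?p \<omega> * ?p \<omega>)"
  proof (rule integrable_const_bound[where B=1])
    show "AE \<omega> in M. norm (?p \<omega> * ?p \<omega>) \<le> 1"
      using cond_prob_bounds[OF E] by eventually_elim (simp add: mult_le_one)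
  qed measurable
  have expand: "(?p \<omega> - ?c)\<^sup>2 = ?p \<omega> * ?p \<omega> - 2 * ?c * ?p \<omega> + ?c\<^sup>2" for \<omega>
    by (simp add: power2_eq_square algebra_simps)
  show "integrable M (\<lambda>\<omega>. (?p \<omega> - ?c)\<^sup>2)"
    unfolding expand using int int2 by simp
  have "(\<integral>\<omega>. (?p \<omega> - ?c)\<^sup>2 \<partial>M) = (\<integral>\<omega>. ?p \<omega> * ?p \<omega> \<partial>M) - 2 * ?c * (\<integral>\<omega>. ?p \<omega> \<partial>M) + ?c\<^sup>2"
    unfolding expand using int int2 prob_space by simp
  also have "\<dots> = \<P>(\<omega> in M. Y \<omega> \<in> A \<and> Y' \<omega> \<in> A) - 2 * ?c * ?c + ?c\<^sup>2"
    by (simp only: integral_cond_prob[OF E] joint_prob[OF A A])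
  finally show "(\<integral>\<omega>. (?p \<omega> - ?c)\<^sup>2 \<partial>M) = \<P>(\<omega> in M. Y \<omega> \<in> A \<and> Y' \<omega> \<in> A) - ?c\<^sup>2"
    by (simp add: power2_eq_square)
qed

lemma joint_prob_ge_square:
  assumes A: "A \<in> sets borel"
  shows "(\<P>(\<omega> in M. Y \<omega> \<in> A))\<^sup>2 \<le> \<P>(\<omega> in M. Y \<omega> \<in> A \<and> Y' \<omega> \<in> A)"
proof -
  have "0 \<le> (\<integral>\<omega>. (cond_law A \<omega> - \<P>(\<omega> in M. Y \<omega> \<in> A))\<^sup>2 \<partial>M)"
    by (intro integral_nonneg_AE) simp
  then show ?thesis
    by (simp add: cond_law_variance(2)[OF A])
qed

text \<open>The conditional probability has variance zero, so it is almost surely constant.\<close>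

lemma indep_event_if_joint_prob_eq_square:
  assumes A [measurable]: "A \<in> sets borel" and B: "B \<in> sets borel"
    and eq: "\<P>(\<omega> in M. Y \<omega> \<in> A \<and> Y' \<omega> \<in> A) = (\<P>(\<omega> in M. Y \<omega> \<in> A))\<^sup>2"
  shows "prob ({\<omega> \<in> space M. Y \<omega> \<in> A} \<inter> (W -` B \<inter> space M)) =
    \<P>(\<omega> in M. Y \<omega> \<in> A) * prob (W -` B \<inter> space M)"
proof -
  let ?c = "\<P>(\<omega> in M. Y \<omega> \<in> A)"
  have V [measurable]: "W -` B \<inter> space M \<in> events"
    using measurable_sets[OF W_meas B] .
  have "AE \<omega> in M. (cond_law A \<omega> - ?c)\<^sup>2 = 0"
    using cond_law_variance[OF A] eq
      integral_nonneg_eq_0_iff_AE[of M "\<lambda>\<omega>. (cond_law A \<omega> - ?c)\<^sup>2"] by simp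
  then have const: "AE \<omega> in M. cond_law A \<omega> = ?c"
    by simp
  have "prob ({\<omega> \<in> space M. Y \<omega> \<in> A} \<inter> (W -` B \<inter> space M)) =
      (\<integral>\<omega>. indicator (W -` B \<inter> space M) \<omega> * cond_law A \<omega> \<partial>M)"
    by (rule prob_Int_W[OF _ B]) measurable
  also have "\<dots> = (\<integral>\<omega>. indicator (W -` B \<inter> space M) \<omega> * ?c \<partial>M)"
    using const by (intro integral_cong_AE) auto
  also have "\<dots> = ?c * prob (W -` B \<inter> space M)"
    using V by (simp add: emeasure_eq_measure)
  finally show ?thesis .
qed

text \<open>A constant is trivially measurable, and by independence it has the right integral
  over every event generated by \<open>W\<close>.\<close>

lemma cond_law_eq_if_indep:
  assumes indep: "indep_random_vars M Y W" and A [measurable]: "A \<in> sets borel"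
  shows "AE \<omega> in M. cond_law A \<omega> = \<P>(\<omega> in M. Y \<omega> \<in> A)"
proof -
  let ?E = "{\<omega> \<in> space M. Y \<omega> \<in> A}"
  have E: "?E \<in> events"
    by measurable
  show ?thesis
    unfolding cond_prob_given_def
  proof (rule W.real_cond_exp_charact)
    fix V assume "V \<in> sets (vimage_algebra (space M) W borel)"
    then obtain B where B: "B \<in> sets borel" and V: "V = W -` B \<inter> space M"
      by (auto simp: sets_vimage_W)
    have V_event: "V \<in> events"
      using measurable_sets[OF W_meas B] V by simp
    have "(\<integral>\<omega>\<in>V. indicator ?E \<omega> \<partial>M) = prob (?E \<inter> V)"
      using E V_event
      by (simp add: set_lebesgue_integral_def indicator_inter_arith[symmetric] Int_commute)
    also have "?E = Y -` A \<inter> space M"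
      by auto
    also have "prob (Y -` A \<inter> space M \<inter> V) = prob (Y -` A \<inter> space M) * prob V"
      using indep indep_random_vars_iff[OF prob_space_axioms Y_meas W_meas] A B V by simp
    also have "Y -` A \<inter> space M = ?E"
      by auto
    finally show "(\<integral>\<omega>\<in>V. indicator ?E \<omega> \<partial>M) = (\<integral>\<omega>\<in>V. prob ?E \<partial>M)"
      using V_event by (simp add: set_lebesgue_integral_def emeasure_eq_measure)
  qed (use integrable_indicator_event[OF E] in auto)
qed

lemma joint_law_if_indep:
  assumes indep: "indep_random_vars M Y W"
  shows "distr M (borel \<Otimes>\<^sub>M borel) (\<lambda>\<omega>. (Y \<omega>, Y' \<omega>)) = distr M borel Y \<Otimes>\<^sub>M distr M borel Y"
proof (rule pair_measure_eqI[symmetric])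
  interpret D: prob_space "distr M borel Y"
    by (rule prob_space_distr) measurable
  show "sigma_finite_measure (distr M borel Y)"
    by unfold_locales
  then show "sigma_finite_measure (distr M borel Y)" .
  show "sets (distr M borel Y \<Otimes>\<^sub>M distr M borel Y) =
      sets (distr M (borel \<Otimes>\<^sub>M borel) (\<lambda>\<omega>. (Y \<omega>, Y' \<omega>)))"
    by simp
  fix A B assume "A \<in> sets (distr M borel Y)" "B \<in> sets (distr M borel Y)"
  then have A [measurable]: "A \<in> sets borel" and B [measurable]: "B \<in> sets borel"
    by auto
  have "prob ((\<lambda>\<omega>. (Y \<omega>, Y' \<omega>)) -` (A \<times> B) \<inter> space M) = \<P>(\<omega> in M. Y \<omega> \<in> A \<and> Y' \<omega> \<in> B)"
    by (intro arg_cong[where f=prob]) auto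
  also have "\<dots> = (\<integral>\<omega>. cond_law A \<omega> * cond_law B \<omega> \<partial>M)"
    by (rule joint_prob[OF A B])
  also have "\<dots> = (\<integral>\<omega>. \<P>(\<omega> in M. Y \<omega> \<in> A) * \<P>(\<omega> in M. Y \<omega> \<in> B) \<partial>M)"
    using cond_law_eq_if_indep[OF indep A] cond_law_eq_if_indep[OF indep B]
    by (intro integral_cong_AE) auto
  also have "\<dots> = \<P>(\<omega> in M. Y \<omega> \<in> A) * \<P>(\<omega> in M. Y \<omega> \<in> B)"
    using prob_space by simp
  finally show "emeasure (distr M borel Y) A * emeasure (distr M borel Y) B =
      emeasure (distr M (borel \<Otimes>\<^sub>M borel) (\<lambda>\<omega>. (Y \<omega>, Y' \<omega>))) (A \<times> B)"
    by (simp add: emeasure_distr emeasure_eq_measure ennreal_mult'[symmetric] vimage_def Int_def conj_commute)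
qed

lemma phi_eq_iff_indep:
  assumes cont: "continuous_on UNIV (distribution_function M Y)"
  shows "(\<forall>t\<in>{0..1}. phi M Y Y' t = 2 * t - t\<^sup>2) \<longleftrightarrow> indep_random_vars M Y W"
proof -
  define D where "D = distr M borel Y"
  have D: "real_distribution D"
    unfolding D_def by (rule real_distribution_distr) (rule Y_meas)
  then interpret D: real_distribution D .
  have F: "distribution_function M Y = cdf D"
    by (simp add: distribution_function_def D_def)
  have cont_D: "continuous_on UNIV (cdf D)"
    using cont by (simp only: F)
  have phi: "phi M Y Y' t = \<P>(\<omega> in M. \<bar>cdf D (Y \<omega>) - cdf D (Y' \<omega>)\<bar> \<le> t)" for t
    by (simp add: phi_def F)
  have cdf_D: "cdf D y = \<P>(\<omega> in M. Y \<omega> \<in> {..y})" for y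
    unfolding D_def cdf_def by (subst measure_distr) (auto intro!: arg_cong[where f=prob])
  show ?thesis
  proof
    assume phi_eq: "\<forall>t\<in>{0..1}. phi M Y Y' t = 2 * t - t\<^sup>2"
    have "\<P>(\<omega> in M. Y \<omega> \<le> y \<and> Y' \<omega> \<le> y) = (cdf D y)\<^sup>2" for y
    proof (rule joint_cdf_eq_square[OF D cont_D Y_meas Y'_meas])
      show "distr M borel Y = D" "distr M borel Y' = D"
        by (simp_all add: D_def copy_law)
      show "\<P>(\<omega> in M. \<bar>cdf D (Y \<omega>) - cdf D (Y' \<omega>)\<bar> \<le> t) = 2 * t - t\<^sup>2"
        if "0 \<le> t" "t \<le> 1" for t
        using phi_eq that by (simp add: phi)
      show "(cdf D z)\<^sup>2 \<le> \<P>(\<omega> in M. Y \<omega> \<le> z \<and> Y' \<omega> \<le> z)" for z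
        using joint_prob_ge_square[of "{..z}"] by (simp add: cdf_D)
    qed
    then have eq: "\<P>(\<omega> in M. Y \<omega> \<in> {..y} \<and> Y' \<omega> \<in> {..y}) = (\<P>(\<omega> in M. Y \<omega> \<in> {..y}))\<^sup>2" for y
      by (simp add: cdf_D)
    show "indep_random_vars M Y W"
    proof (rule indep_random_vars_realI[OF prob_space_axioms Y_meas W_meas])
      fix y and B :: "'c set" assume B: "B \<in> sets borel"
      have "Y -` {..y} \<inter> space M = {\<omega> \<in> space M. Y \<omega> \<in> {..y}}"
        by auto
      then show "prob ((Y -` {..y} \<inter> space M) \<inter> (W -` B \<inter> space M)) =
          prob (Y -` {..y} \<inter> space M) * prob (W -` B \<inter> space M)"
        using indep_event_if_joint_prob_eq_square[OF _ B eq[of y]] by simp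
    qed
  next
    assume indep: "indep_random_vars M Y W"
    show "\<forall>t\<in>{0..1}. phi M Y Y' t = 2 * t - t\<^sup>2"
    proof
      fix t :: real assume t: "t \<in> {0..1}"
      have F_meas [measurable]: "cdf D \<in> borel_measurable borel"
        using cont_D by (rule borel_measurable_continuous_onI)
      let ?S = "{p \<in> space (borel \<Otimes>\<^sub>M borel). \<bar>cdf D (fst p) - cdf D (snd p)\<bar> \<le> t}"
      have S: "?S \<in> sets (borel \<Otimes>\<^sub>M borel)"
        by measurable
      have "phi M Y Y' t = prob ((\<lambda>\<omega>. (Y \<omega>, Y' \<omega>)) -` ?S \<inter> space M)"
        unfolding phi by (intro arg_cong[where f=prob]) (auto simp: space_pair_measure)
      also have "\<dots> = measure (distr M (borel \<Otimes>\<^sub>M borel) (\<lambda>\<omega>. (Y \<omega>, Y' \<omega>))) ?S"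
        by (rule measure_distr[symmetric, OF _ S]) measurable
      also have "\<dots> = measure (D \<Otimes>\<^sub>M D) ?S"
        unfolding D_def joint_law_if_indep[OF indep] ..
      also have "?S = {p \<in> space (D \<Otimes>\<^sub>M D). \<bar>cdf D (fst p) - cdf D (snd p)\<bar> \<le> t}"
        by (simp add: space_pair_measure)
      also have "measure (D \<Otimes>\<^sub>M D) \<dots> = 2 * t - t\<^sup>2"
        using t by (intro D.pair_prob_cdf_diff_le[OF cont_D]) auto
      finally show "phi M Y Y' t = 2 * t - t\<^sup>2" .
    qed
  qed
qed

end

section \<open>Passing to an extension of the probability space\<close>

lemma indep_random_vars_extension:
  assumes ext: "prob_space_extension M N \<pi>" and M: "prob_space M"
    and U: "U \<in> borel_measurable M" and V: "V \<in> borel_measurable M"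
  shows "indep_random_vars N (U \<circ> \<pi>) (V \<circ> \<pi>) \<longleftrightarrow> indep_random_vars M U V"
proof -
  have N: "prob_space N" and \<pi>: "\<pi> \<in> measurable N M" and law: "distr N M \<pi> = M"
    using ext by (auto simp: prob_space_extension_def)
  have pull: "measure N (\<pi> -` E \<inter> space N) = measure M E" if "E \<in> sets M" for E
    using measure_distr[OF \<pi> that] by (simp add: law)
  have U_pull: "(U \<circ> \<pi>) -` A \<inter> space N = \<pi> -` (U -` A \<inter> space M) \<inter> space N" for A
    using measurable_space[OF \<pi>] by auto
  have V_pull: "(V \<circ> \<pi>) -` A \<inter> space N = \<pi> -` (V -` A \<inter> space M) \<inter> space N" for A
    using measurable_space[OF \<pi>] by auto
  have Int_pull: "(\<pi> -` E \<inter> space N) \<inter> (\<pi> -` E' \<inter> space N) = \<pi> -` (E \<inter> E') \<inter> space N" for E E'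
    by auto
  show ?thesis
    unfolding indep_random_vars_iff[OF M U V]
      indep_random_vars_iff[OF N measurable_comp[OF \<pi> U] measurable_comp[OF \<pi> V]]
      U_pull V_pull Int_pull
    by (intro ball_cong refl) (simp only: pull measurable_sets[OF U] measurable_sets[OF V] sets.Int)
qed

theorem theorem2p1:
  fixes M :: "'a measure" and N :: "'b measure" and \<pi> :: "'b \<Rightarrow> 'a"
    and Y :: "'a \<Rightarrow> real" and X :: "'a \<Rightarrow> real ^ 'd" and Y' :: "'b \<Rightarrow> real"
  assumes "prob_space M"
    and "Y \<in> borel_measurable M" and "X \<in> borel_measurable M"
    and "continuous_on UNIV (distribution_function M Y)"
    and "prob_space_extension M N \<pi>"
    and "cond_iid_copy N (X \<circ> \<pi>) (Y \<circ> \<pi>) Y'"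
  shows "(\<forall>t\<in>{0..1}. phi N (Y \<circ> \<pi>) Y' t = 2 * t - t\<^sup>2) \<longleftrightarrow> indep_random_vars M Y X"
proof -
  have N: "prob_space N" and \<pi>: "\<pi> \<in> measurable N M" and law: "distr N M \<pi> = M"
    using assms(5) by (auto simp: prob_space_extension_def)
  interpret cond_iid_pair N "X \<circ> \<pi>" "Y \<circ> \<pi>" Y'
    using N measurable_comp[OF \<pi> assms(2)] measurable_comp[OF \<pi> assms(3)] assms(6)
    by (intro cond_iid_pair.intro cond_iid_pair_axioms.intro)
  have "distribution_function N (Y \<circ> \<pi>) = distribution_function M Y"
    using distr_distr[OF assms(2) \<pi>] by (simp add: distribution_function_def law)
  then have "(\<forall>t\<in>{0..1}. phi N (Y \<circ> \<pi>) Y' t = 2 * t - t\<^sup>2) \<longleftrightarrow>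
      indep_random_vars N (Y \<circ> \<pi>) (X \<circ> \<pi>)"
    using assms(4) by (intro phi_eq_iff_indep) simp
  also have "\<dots> \<longleftrightarrow> indep_random_vars M Y X"
    by (rule indep_random_vars_extension[OF assms(5,1,2,3)])
  finally show ?thesis .
qed

end
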